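(* Every covering space $\widetilde G$ of a connected locally path connected topological group $G$ is a topological group. Furthermore, the covering map $q:\widetilde G\to G$ is a homomorphism.
   Context: A covering space of $G$ is a pair $(\widetilde G,q)$ consisting of a topological space $\widetilde G$ and a covering map $q:\widetilde G\to G$, that is, a continuous surjection such that every point of $G$ has an open neighborhood $U$ for which $q^{-1}(U)$ is a disjoint union of open subsets of $\widetilde G$, each mapped homeomorphically onto $U$ by $q$. That $\widetilde G$ is a topological group means that the space $\widetilde G$ can be given a group structure making it a topological group; $q$ is a group homomorphism with respect to this structure.
   Formalization: The covering space is additionally assumed to be connected; without this the claim is false, e.g. for the disjoint union of the circle (identity map) and the real line (exponential map) covering the circle, whose components are not homeomorphic. *)

theory Defs
  imports "HOL-Analysis.Analysis" "HOL-Algebra.Group"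
begin

text \<open>No separation axiom is part of the notion of topological group.\<close>

locale topological_group = group G for G (structure) +
  fixes T :: "'g topology"
  assumes topspace_eq: "topspace T = carrier G"
    and continuous_mult: "continuous_map (prod_topology T T) T (\<lambda>(x, y). x \<otimes> y)"
    and continuous_inv: "continuous_map T T (\<lambda>x. inv x)"

text \<open>The class constraints on the covering space predicate of HOL-Analysis tie it to subsets of a
  topological type; the following is its counterpart for abstract topologies. As there, the total
  space is allowed to be disconnected and the sheets over \<open>U\<close> form the family \<open>\<V>\<close>.\<close>

definition covering_map :: "'a topology \<Rightarrow> 'b topology \<Rightarrow> ('a \<Rightarrow> 'b) \<Rightarrow> bool" where
  "covering_map X Y q \<longleftrightarrow>
     continuous_map X Y q \<and> q ` topspace X = topspace Y \<and>
     (\<forall>y \<in> topspace Y. \<exists>U. openin Y U \<and> y \<in> U \<and>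
        (\<exists>\<V>. \<Union>\<V> = {x \<in> topspace X. q x \<in> U} \<and> pairwise disjnt \<V> \<and>
             (\<forall>V \<in> \<V>. openin X V \<and>
                 homeomorphic_map (subtopology X V) (subtopology Y U) q)))"

end

theory Submission
  imports Defs
begin

text \<open>The idea is to lift the multiplication of \<open>G\<close>. Write \<open>E\<close> for the covering space, which is again
  locally path connected and hence path connected, and choose a point \<open>e\<close> over the unit. The map
  \<open>M (a, b) = q a \<otimes> q b\<close> from \<open>E \<times> E\<close> to \<open>G\<close> restricts to \<open>q\<close> on both axes \<open>E \<times> {e}\<close> and \<open>{e} \<times> E\<close>,
  where the identity of \<open>E\<close> is a lift. Such a compatible pair of lifts extends to a lift \<open>m\<close> of \<open>M\<close>
  on all of \<open>E \<times> E\<close> (\<open>product_lifting\<close>). By construction \<open>e\<close> is a unit for \<open>m\<close> and \<open>q\<close> is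
  multiplicative.

  The group laws follow from uniqueness of lifts (\<open>covering_map_lift_unique\<close>): two lifts of one map on a
  connected space agree as soon as they agree at one point. For associativity this applies to
  \<open>a \<mapsto> m (m (a, b), c)\<close> and \<open>a \<mapsto> m (a, m (b, c))\<close>, which agree at \<open>e\<close>. For inverses, let \<open>\<beta>\<close> be a path
  from \<open>e\<close> to \<open>b\<close> and let \<open>\<beta>'\<close> be the lift of \<open>t \<mapsto> inv (q (\<beta> t))\<close> starting at \<open>e\<close>; then
  \<open>m (\<beta>' t, \<beta> t)\<close> lifts the constant path at the unit and starts at \<open>e\<close>, so it is constantly \<open>e\<close>, and
  \<open>\<beta>' 1\<close> is a left inverse of \<open>b\<close>. The same argument shows that inversion is continuous along every
  path, which on a locally path connected space makes it continuous
  (\<open>continuous_map_if_continuous_along_paths\<close>).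

  The topological input to all of this is the lifting of homotopies \<open>X \<times> [0,1] \<rightarrow> B\<close> through a
  covering map (\<open>homotopy_lifting\<close>).\<close>

section \<open>Sheets and uniqueness of lifts\<close>

text \<open>The second condition makes \<open>V\<close> closed, besides open, in the preimage of \<open>U\<close>. For a single sheet
  this records all that is needed of its disjointness from the other ones, without mentioning
  the whole family.\<close>

definition sheet_over :: "'e topology \<Rightarrow> 'b topology \<Rightarrow> ('e \<Rightarrow> 'b) \<Rightarrow> 'b set \<Rightarrow> 'e set \<Rightarrow> bool" where
  "sheet_over E B q U V \<longleftrightarrow>
     openin E V \<and> openin E ({x \<in> topspace E. q x \<in> U} - V) \<and>
     homeomorphic_map (subtopology E V) (subtopology B U) q"

lemma covering_map_sheets:
  assumes cov: "covering_map E B q" and b: "b \<in> topspace B"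
  obtains U where "openin B U" "b \<in> U"
    "\<And>a. \<lbrakk>a \<in> topspace E; q a \<in> U\<rbrakk> \<Longrightarrow> \<exists>V. sheet_over E B q U V \<and> a \<in> V"
proof -
  obtain U \<V> where U: "openin B U" "b \<in> U"
    and un: "\<Union>\<V> = {x \<in> topspace E. q x \<in> U}" and disj: "pairwise disjnt \<V>"
    and sheets: "\<And>V. V \<in> \<V> \<Longrightarrow> openin E V \<and>
                   homeomorphic_map (subtopology E V) (subtopology B U) q"
    using cov b unfolding covering_map_def by meson
  have "\<exists>V. sheet_over E B q U V \<and> a \<in> V" if a: "a \<in> topspace E" "q a \<in> U" for a
  proof -
    from a un obtain V where V: "V \<in> \<V>" "a \<in> V"
      by blast
    have "{x \<in> topspace E. q x \<in> U} - V = \<Union>(\<V> - {V})"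
      unfolding un[symmetric] using disj V(1) by (auto simp: pairwise_def disjnt_iff)
    moreover have "openin E (\<Union>(\<V> - {V}))"
      using sheets by blast
    ultimately show ?thesis
      using V sheets unfolding sheet_over_def by metis
  qed
  with U show ?thesis
    using that by blast
qed

lemma sheet_over_subset:
  assumes "sheet_over E B q U V"
  shows "V \<subseteq> {x \<in> topspace E. q x \<in> U}"
proof -
  have "V \<subseteq> topspace E"
    using assms by (simp add: sheet_over_def openin_subset)
  moreover have "q ` topspace (subtopology E V) = topspace (subtopology B U)"
    using assms homeomorphic_imp_surjective_map unfolding sheet_over_def by blast
  ultimately show ?thesis
    by auto
qed

lemma sheet_over_inj_on:
  assumes "sheet_over E B q U V"
  shows "inj_on q V"
proof -
  have "inj_on q (topspace (subtopology E V))"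
    using assms homeomorphic_imp_injective_map unfolding sheet_over_def by blast
  moreover have "V \<subseteq> topspace E"
    using assms by (simp add: sheet_over_def openin_subset)
  ultimately show ?thesis
    by (simp add: Int_absorb1)
qed

lemma sheet_over_open_image:
  assumes V: "sheet_over E B q U V" and U: "openin B U" and W: "openin E W" "W \<subseteq> V"
  shows "openin B (q ` W)"
proof -
  have "openin (subtopology E V) W"
    using V W by (simp add: sheet_over_def openin_open_subtopology)
  then have "openin (subtopology B U) (q ` W)"
    using V homeomorphic_imp_open_map unfolding sheet_over_def open_map_def by blast
  with U show ?thesis
    by (simp add: openin_open_subtopology)
qed

text \<open>A sheet is open and closed in the preimage of \<open>U\<close>, so a connected set in that preimage that
  meets the sheet stays in it.\<close>

lemma connected_lift_in_sheet:
  assumes Y: "connected_space Y" and k: "continuous_map Y E k"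
    and V: "sheet_over E B q U V" and inU: "\<And>y. y \<in> topspace Y \<Longrightarrow> q (k y) \<in> U"
    and y0: "y0 \<in> topspace Y" "k y0 \<in> V" and y: "y \<in> topspace Y"
  shows "k y \<in> V"
proof (rule ccontr)
  assume "k y \<notin> V"
  let ?W = "{x \<in> topspace E. q x \<in> U} - V"
  have "openin Y {z \<in> topspace Y. k z \<in> V}" "openin Y {z \<in> topspace Y. k z \<in> ?W}"
    using V by (auto simp only: sheet_over_def intro!: openin_continuous_map_preimage[OF k])
  moreover have "topspace Y \<subseteq> {z \<in> topspace Y. k z \<in> V} \<union> {z \<in> topspace Y. k z \<in> ?W}"
    using inU k by (auto simp: continuous_map_def)
  moreover have "{z \<in> topspace Y. k z \<in> V} \<noteq> {}"
    using y0 by blast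
  moreover have "{z \<in> topspace Y. k z \<in> ?W} \<noteq> {}"
    using y \<open>k y \<notin> V\<close> inU k by (auto simp: continuous_map_def)
  moreover have "{z \<in> topspace Y. k z \<in> V} \<inter> {z \<in> topspace Y. k z \<in> ?W} = {}"
    by blast
  ultimately show False
    using Y unfolding connected_space_def by meson
qed

text \<open>Near a given point both lifts stay in one sheet each. If the sheets are the same, injectivity
  of \<open>q\<close> on it makes the lifts agree; otherwise they differ nearby. So agreement is a locally
  constant property.\<close>

lemma covering_map_lift_unique:
  assumes cov: "covering_map E B q" and Y: "connected_space Y"
    and f: "continuous_map Y E f" and g: "continuous_map Y E g"
    and fg: "\<And>y. y \<in> topspace Y \<Longrightarrow> q (f y) = q (g y)"
    and y0: "y0 \<in> topspace Y" "f y0 = g y0" and y: "y \<in> topspace Y"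
  shows "f y = g y"
proof (rule ccontr)
  assume neq: "f y \<noteq> g y"
  have local: "\<exists>W. openin Y W \<and> z \<in> W \<and> (\<forall>w\<in>W. f w = g w \<longleftrightarrow> f z = g z)"
    if z: "z \<in> topspace Y" for z
  proof -
    have fz: "f z \<in> topspace E" and gz: "g z \<in> topspace E"
      using f g z by (auto simp: continuous_map_def)
    then have "q (f z) \<in> topspace B"
      using cov by (auto simp: covering_map_def)
    then obtain U where U: "openin B U" "q (f z) \<in> U"
      "\<And>a. \<lbrakk>a \<in> topspace E; q a \<in> U\<rbrakk> \<Longrightarrow> \<exists>V. sheet_over E B q U V \<and> a \<in> V"
      using covering_map_sheets[OF cov] by metis
    then obtain V where V: "sheet_over E B q U V" "f z \<in> V"
      using fz by blast
    have inj: "inj_on q V"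
      using V(1) by (rule sheet_over_inj_on)
    \<comment> \<open>\<open>A\<close> separates \<open>g\<close> from the sheet of \<open>f z\<close> exactly when \<open>g z\<close> is not in it; as \<open>q\<close> is injective on the
      sheet, this is the case \<open>f z \<noteq> g z\<close>.\<close>
    define A where "A = (if f z = g z then V else {x \<in> topspace E. q x \<in> U} - V)"
    have A: "openin E A"
      using V(1) by (simp add: A_def sheet_over_def)
    have gA: "g z \<in> A"
      using inj V(2) gz fg[OF z] U(2) by (auto simp: A_def inj_on_def)
    let ?W = "{w \<in> topspace Y. f w \<in> V} \<inter> {w \<in> topspace Y. g w \<in> A}"
    have "openin Y ?W"
      using f g A V(1)
      by (auto simp: sheet_over_def intro!: openin_Int openin_continuous_map_preimage)
    moreover have "\<forall>w\<in>?W. f w = g w \<longleftrightarrow> f z = g z"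
      using inj fg by (auto simp: A_def inj_on_def split: if_splits)
    ultimately show ?thesis
      using z V(2) gA by blast
  qed
  have opn: "openin Y {z \<in> topspace Y. (f z = g z) = c}" for c
  proof (subst openin_subopen, intro ballI)
    fix z assume z: "z \<in> {z \<in> topspace Y. (f z = g z) = c}"
    then obtain W where W: "openin Y W" "z \<in> W" "\<forall>w\<in>W. f w = g w \<longleftrightarrow> f z = g z"
      using local by blast
    with z have "W \<subseteq> {z \<in> topspace Y. (f z = g z) = c}"
      using openin_subset[OF W(1)] by blast
    with W show "\<exists>T. openin Y T \<and> z \<in> T \<and> T \<subseteq> {z \<in> topspace Y. (f z = g z) = c}"
      by blast
  qed
  have "openin Y {z \<in> topspace Y. f z = g z}" "openin Y {z \<in> topspace Y. f z \<noteq> g z}"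
    using opn[of True] opn[of False] by simp_all
  moreover have "topspace Y \<subseteq> {z \<in> topspace Y. f z = g z} \<union> {z \<in> topspace Y. f z \<noteq> g z}"
    by blast
  moreover have "{z \<in> topspace Y. f z = g z} \<inter> {z \<in> topspace Y. f z \<noteq> g z} = {}"
    by blast
  moreover have "{z \<in> topspace Y. f z = g z} \<noteq> {}" "{z \<in> topspace Y. f z \<noteq> g z} \<noteq> {}"
    using y0 y neq by blast+
  ultimately show False
    using Y unfolding connected_space_def by meson
qed

section \<open>Lifting of homotopies and paths\<close>

lemma connected_unit_interval: "connected_space (top_of_set {0..1::real})"
  by (simp flip: connectedin_def add: connected_space_subtopology)

text \<open>Continuous induction on the time \<open>s\<close> up to which the homotopy has been lifted near \<open>x0\<close>.
  Around every time \<open>s0\<close> there is an interval during which \<open>h\<close> stays, for all \<open>x\<close> close to \<open>x0\<close>, in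
  one evenly covered open set; on that interval a lift can be prolonged through the local inverse
  of \<open>q\<close>, after shrinking the neighborhood of \<open>x0\<close> so that the lift has reached a single sheet.
  Hence the set of good times is both open and closed in the unit interval.\<close>

lemma local_homotopy_lifting:
  fixes h :: "'x \<times> real \<Rightarrow> 'b"
  assumes cov: "covering_map E B q"
    and h: "continuous_map (prod_topology X (top_of_set {0..1})) B h"
    and f: "continuous_map X E f" and hf: "\<And>x. x \<in> topspace X \<Longrightarrow> q (f x) = h (x, 0)"
    and x0: "x0 \<in> topspace X"
  obtains N K where "openin X N" "x0 \<in> N"
    "continuous_map (prod_topology (subtopology X N) (top_of_set {0..1})) E K"
    "\<And>x. x \<in> N \<Longrightarrow> K (x, 0) = f x"
    "\<And>x t. \<lbrakk>x \<in> N; t \<in> {0..1}\<rbrakk> \<Longrightarrow> q (K (x, t)) = h (x, t)"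
proof -
  let ?I = "top_of_set {0..1::real}"
  \<comment> \<open>A good lift follows \<open>h\<close> up to time \<open>s\<close> and then lifts the homotopy stopped at time \<open>s\<close>; the
    domain is thereby the same for all \<open>s\<close>.\<close>
  define good where "good s N K \<longleftrightarrow>
      openin X N \<and> x0 \<in> N \<and> continuous_map (prod_topology (subtopology X N) ?I) E K \<and>
      (\<forall>x\<in>N. K (x, 0) = f x \<and> (\<forall>t\<in>{0..1}. q (K (x, t)) = h (x, min t s)))" for s :: real and N K
  define P where "P s \<longleftrightarrow> (\<exists>N K. good s N K)" for s
  have clamp: "continuous_map (prod_topology (subtopology X N) ?I) (prod_topology X ?I)
                 (\<lambda>z. (fst z, min (snd z) s))" if "s \<in> {0..1}" for s N
  proof (intro continuous_map_pairedI)
    show "continuous_map (prod_topology (subtopology X N) ?I) X fst"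
      using continuous_map_fst continuous_map_into_fulltopology by blast
    have "continuous_map (prod_topology (subtopology X N) ?I) euclideanreal (\<lambda>z. min (snd z) s)"
      by (intro continuous_intros continuous_map_real_min)
         (use continuous_map_snd continuous_map_into_fulltopology in blast)
    then show "continuous_map (prod_topology (subtopology X N) ?I) ?I (\<lambda>z. min (snd z) s)"
      using that by (auto simp: continuous_map_in_subtopology)
  qed
  have P0: "P 0"
  proof -
    have "continuous_map (prod_topology (subtopology X (topspace X)) ?I) E (f \<circ> fst)"
      using f by (auto intro!: continuous_map_compose[OF continuous_map_fst])
    then have "good 0 (topspace X) (f \<circ> fst)"
      using hf x0 by (auto simp: good_def)
    then show ?thesis
      by (auto simp: P_def)
  qed
  have step: "\<exists>T. openin ?I T \<and> s0 \<in> T \<and> (\<forall>s\<in>T. \<forall>s'\<in>T. P s \<longrightarrow> P s')"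
    if s0: "s0 \<in> {0..1}" for s0
  proof -
    have hx0: "h (x0, s0) \<in> topspace B"
      using h x0 s0 by (auto simp: continuous_map_def)
    obtain U where U: "openin B U" "h (x0, s0) \<in> U"
      "\<And>a. \<lbrakk>a \<in> topspace E; q a \<in> U\<rbrakk> \<Longrightarrow> \<exists>V. sheet_over E B q U V \<and> a \<in> V"
      using covering_map_sheets[OF cov hx0] by metis
    have "openin (prod_topology X ?I) {z \<in> topspace (prod_topology X ?I). h z \<in> U}"
      using h U(1) by (rule openin_continuous_map_preimage)
    moreover have "(x0, s0) \<in> {z \<in> topspace (prod_topology X ?I). h z \<in> U}"
      using x0 s0 U(2) by auto
    ultimately obtain N0 T0 where N0: "openin X N0" "x0 \<in> N0" and T0: "openin ?I T0" "s0 \<in> T0"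
      and NT: "N0 \<times> T0 \<subseteq> {z \<in> topspace (prod_topology X ?I). h z \<in> U}"
      unfolding openin_prod_topology_alt by blast
    then obtain e where e: "e > 0" "ball s0 e \<inter> {0..1} \<subseteq> T0"
      unfolding openin_contains_ball by blast
    define T where "T = {0..1} \<inter> ball s0 e"
    have hU: "h (x, t) \<in> U" if "x \<in> N0" "t \<in> T" for x t
    proof -
      have "(x, t) \<in> N0 \<times> T0"
        using e that by (auto simp: T_def)
      with NT show ?thesis
        by blast
    qed
    have T01: "T \<subseteq> {0..1}"
      by (auto simp: T_def)
    have Tconv: "t \<in> T" if "s \<in> T" "s' \<in> T" "s \<le> t" "t \<le> s'" for s s' t
      using that by (auto simp: T_def dist_real_def)
    have "P s'" if s: "s \<in> T" and s': "s' \<in> T" and Ps: "P s" for s s'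
    proof -
      obtain N K where NK: "good s N K"
        using Ps by (auto simp: P_def)
      then have N: "openin X N" "x0 \<in> N"
        and K: "continuous_map (prod_topology (subtopology X N) ?I) E K"
        and K0: "\<And>x. x \<in> N \<Longrightarrow> K (x, 0) = f x"
        and qK: "\<And>x t. \<lbrakk>x \<in> N; t \<in> {0..1}\<rbrakk> \<Longrightarrow> q (K (x, t)) = h (x, min t s)"
        by (auto simp: good_def)
      have s01: "s \<in> {0..1}" "s' \<in> {0..1}"
        using s s' T01 by auto
      show ?thesis
      proof (cases "s' \<le> s")
        case True
        have "continuous_map (prod_topology (subtopology X N) ?I) (prod_topology (subtopology X N) ?I)
                 (\<lambda>z. (fst z, min (snd z) s'))"
          using clamp[OF s01(2), of N]
          by (auto simp: continuous_map_paired continuous_map_in_subtopology)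
        from continuous_map_compose[OF this K]
        have "good s' N (\<lambda>z. K (fst z, min (snd z) s'))"
          using N K0 qK s01 True by (auto simp: good_def o_def min_def)
        then show ?thesis
          by (auto simp: P_def)
      next
        case False
        then have ss': "s < s'"
          by simp
        have Kx0: "K (x0, s) \<in> topspace E" "q (K (x0, s)) \<in> U"
          using K N s01 x0 qK[OF N(2) s01(1)] hU[OF N0(2) s] by (auto simp: continuous_map_def)
        then obtain V where V: "sheet_over E B q U V" "K (x0, s) \<in> V"
          using U(3) by blast
        then obtain g where g: "homeomorphic_maps (subtopology E V) (subtopology B U) q g"
          by (auto simp: sheet_over_def homeomorphic_map_maps)
        have Vsub: "V \<subseteq> topspace E"
          using V(1) by (auto dest: sheet_over_subset)
        have Usub: "U \<subseteq> topspace B"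
          using U(1) by (rule openin_subset)
        have gq: "\<And>x. x \<in> V \<Longrightarrow> g (q x) = x" and qg: "\<And>y. y \<in> U \<Longrightarrow> q (g y) = y"
          using g Vsub Usub by (auto simp: homeomorphic_maps_def)
        have gcont: "continuous_map (subtopology B U) E g"
          using g continuous_map_into_fulltopology by (auto simp: homeomorphic_maps_def)
        \<comment> \<open>Over \<open>N'\<close> the lift is in the one sheet \<open>V\<close> at time \<open>s\<close>, so continuing by the inverse \<open>g\<close> of \<open>q\<close>
          on \<open>V\<close> matches it there.\<close>
        define N' where "N' = N0 \<inter> {x \<in> topspace (subtopology X N). K (x, s) \<in> V}"
        have "continuous_map (subtopology X N) E (\<lambda>x. K (x, s))"
          using continuous_map_compose[OF _ K, of "subtopology X N" "\<lambda>x. (x, s)"] s01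
          by (auto simp: o_def continuous_map_paired)
        then have "openin (subtopology X N) {x \<in> topspace (subtopology X N). K (x, s) \<in> V}"
          by (rule openin_continuous_map_preimage) (use V(1) in \<open>simp add: sheet_over_def\<close>)
        then have N': "openin X N'"
          using N N0 by (auto simp: N'_def openin_open_subtopology)
        have N'N: "N' \<subseteq> N" and N'N0: "N' \<subseteq> N0" and N'V: "\<And>x. x \<in> N' \<Longrightarrow> K (x, s) \<in> V"
          by (auto simp: N'_def)
        have x0N': "x0 \<in> N'"
          using N N0 V x0 by (auto simp: N'_def)
        let ?Z = "prod_topology (subtopology X N') ?I"
        define K' where "K' z = (if snd z \<le> s then K z else g (h (fst z, min (snd z) s')))" for z
        have "continuous_map ?Z E K'"
          unfolding K'_def
        proof (rule continuous_map_cases_le)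
          show "continuous_map ?Z euclideanreal snd"
            using continuous_map_snd continuous_map_into_fulltopology by blast
          show "continuous_map ?Z euclideanreal (\<lambda>z. s)"
            by simp
          have "continuous_map ?Z (prod_topology (subtopology X N) ?I) id"
          proof -
            have "continuous_map (subtopology X N') (subtopology X N) id"
              using N'N by (auto simp: continuous_map_in_subtopology continuous_map_from_subtopology)
            from continuous_map_compose[OF continuous_map_fst this] show ?thesis
              by (simp add: continuous_map_pairwise continuous_map_snd)
          qed
          from continuous_map_compose[OF this K]
          show "continuous_map (subtopology ?Z {z \<in> topspace ?Z. snd z \<le> s}) E K"
            by (simp add: continuous_map_from_subtopology)
          have "continuous_map ?Z B (\<lambda>z. h (fst z, min (snd z) s'))"
            using continuous_map_compose[OF clamp[OF s01(2)] h] by (simp add: o_def)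
          moreover have "h (fst z, min (snd z) s') \<in> U" if "z \<in> topspace ?Z" "s \<le> snd z" for z
            using that N'N0 Tconv[OF s s'] ss' by (intro hU) auto
          ultimately have "continuous_map (subtopology ?Z {z \<in> topspace ?Z. s \<le> snd z})
                             (subtopology B U) (\<lambda>z. h (fst z, min (snd z) s'))"
            by (auto simp: continuous_map_in_subtopology continuous_map_from_subtopology)
          from continuous_map_compose[OF this gcont]
          show "continuous_map (subtopology ?Z {z \<in> topspace ?Z. s \<le> snd z}) E
                  (\<lambda>z. g (h (fst z, min (snd z) s')))"
            by (simp add: o_def)
          fix z assume z: "z \<in> topspace ?Z" "snd z = s"
          then obtain x where x: "z = (x, s)" "x \<in> N'"
            by (cases z) auto
          have "q (K (x, s)) = h (x, s)"
            using qK[of x s] x N'N s01 by auto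
          then show "K z = g (h (fst z, min (snd z) s'))"
            using gq[OF N'V[OF x(2)]] x ss' by (simp add: min_def)
        qed
        moreover have "q (K' (x, t)) = h (x, min t s')" if "x \<in> N'" "t \<in> {0..1}" for x t
        proof (cases "t \<le> s")
          case True
          then show ?thesis
            using qK[of x t] that N'N ss' by (auto simp: K'_def min_def)
        next
          case False
          then have "h (x, min t s') \<in> U"
            using that N'N0 Tconv[OF s s'] ss' by (intro hU) auto
          with False show ?thesis
            by (simp add: K'_def qg)
        qed
        ultimately have "good s' N' K'"
          using N' x0N' N'N K0 s01 by (auto simp: good_def K'_def)
        then show ?thesis
          by (auto simp: P_def)
      qed
    qed
    moreover have "openin ?I T" "s0 \<in> T"
      using s0 e by (auto simp: T_def)
    ultimately show ?thesis
      by blast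
  qed
  have "P 1"
    by (rule connected_induction_simple[where S = "{0..1}" and P = P and a = 0])
       (use P0 step in auto)
  then obtain N K where "good 1 N K"
    by (auto simp: P_def)
  then show ?thesis
    using that[of N K] by (auto simp: good_def min_def)
qed

text \<open>The local lifts fit together: on each vertical segment \<open>{x} \<times> [0,1]\<close>, which is connected,
  two of them start at the same point \<open>f x\<close> and therefore coincide.\<close>

lemma homotopy_lifting:
  fixes h :: "'x \<times> real \<Rightarrow> 'b"
  assumes cov: "covering_map E B q"
    and h: "continuous_map (prod_topology X (top_of_set {0..1})) B h"
    and f: "continuous_map X E f" and hf: "\<And>x. x \<in> topspace X \<Longrightarrow> q (f x) = h (x, 0)"
  obtains H where "continuous_map (prod_topology X (top_of_set {0..1})) E H"
    "\<And>x. x \<in> topspace X \<Longrightarrow> H (x, 0) = f x"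
    "\<And>x t. \<lbrakk>x \<in> topspace X; t \<in> {0..1}\<rbrakk> \<Longrightarrow> q (H (x, t)) = h (x, t)"
proof -
  let ?I = "top_of_set {0..1::real}"
  define lift where "lift x0 N K \<longleftrightarrow> openin X N \<and> x0 \<in> N \<and>
      continuous_map (prod_topology (subtopology X N) ?I) E K \<and>
      (\<forall>x\<in>N. K (x, 0) = f x) \<and> (\<forall>x\<in>N. \<forall>t\<in>{0..1}. q (K (x, t)) = h (x, t))" for x0 N K
  have "\<exists>N K. lift x0 N K" if "x0 \<in> topspace X" for x0
    unfolding lift_def using local_homotopy_lifting[OF cov h f hf that] by metis
  then obtain N K where "\<And>x0. x0 \<in> topspace X \<Longrightarrow> lift x0 (N x0) (K x0)"
    by metis
  then have N: "\<And>x0. x0 \<in> topspace X \<Longrightarrow> openin X (N x0)"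
    and inN: "\<And>x0. x0 \<in> topspace X \<Longrightarrow> x0 \<in> N x0"
    and K: "\<And>x0. x0 \<in> topspace X \<Longrightarrow> continuous_map (prod_topology (subtopology X (N x0)) ?I) E (K x0)"
    and K0: "\<And>x0 x. \<lbrakk>x0 \<in> topspace X; x \<in> N x0\<rbrakk> \<Longrightarrow> K x0 (x, 0) = f x"
    and qK: "\<And>x0 x t. \<lbrakk>x0 \<in> topspace X; x \<in> N x0; t \<in> {0..1}\<rbrakk> \<Longrightarrow> q (K x0 (x, t)) = h (x, t)"
    unfolding lift_def by blast+
  have Kpath: "continuous_map ?I E (\<lambda>t. K x0 (x, t))"
    if x0: "x0 \<in> topspace X" and x: "x \<in> N x0" for x0 x
  proof -
    have "x \<in> topspace X"
      using N[OF x0] x openin_subset by blast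
    then show ?thesis
      using continuous_map_compose[OF _ K[OF x0], of ?I "Pair x"] x
      by (auto simp: o_def continuous_map_paired)
  qed
  have agree: "K i z = K j z"
    if i: "i \<in> topspace X" and j: "j \<in> topspace X"
      and z: "z \<in> topspace (prod_topology X ?I) \<inter> (N i \<times> {0..1}) \<inter> (N j \<times> {0..1})" for i j z
  proof -
    obtain x t where xt: "z = (x, t)" "x \<in> N i" "x \<in> N j" "t \<in> {0..1}"
      using z by (cases z) auto
    have "K i (x, t) = K j (x, t)"
      by (rule covering_map_lift_unique[OF cov connected_unit_interval
            Kpath[OF i xt(2)] Kpath[OF j xt(3)], of 0])
         (use qK K0 i j xt in auto)
    then show ?thesis
      using xt by simp
  qed
  have "\<exists>H. continuous_map (prod_topology X ?I) E H \<and>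
      (\<forall>i\<in>topspace X. \<forall>z\<in>topspace (prod_topology X ?I) \<inter> (N i \<times> {0..1}). H z = K i z)"
  proof (rule pasting_lemma_exists[where X = "prod_topology X ?I" and I = "topspace X"
        and T = "\<lambda>i. N i \<times> {0..1}" and Y = E and f = K])
    show "topspace (prod_topology X ?I) \<subseteq> (\<Union>i\<in>topspace X. N i \<times> {0..1})"
      using inN by auto
    show "openin (prod_topology X ?I) (N i \<times> {0..1})" if "i \<in> topspace X" for i
      using N[OF that] by (simp add: openin_prod_Times_iff)
    show "continuous_map (subtopology (prod_topology X ?I) (N i \<times> {0..1})) E (K i)"
      if "i \<in> topspace X" for i
      using K[OF that] by (simp add: subtopology_Times subtopology_subtopology)
    show "K i z = K j z" if "i \<in> topspace X" "j \<in> topspace X"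
      "z \<in> topspace (prod_topology X ?I) \<inter> (N i \<times> {0..1}) \<inter> (N j \<times> {0..1})" for i j z
      using agree[OF that] .
  qed blast
  then obtain H where H: "continuous_map (prod_topology X ?I) E H"
    and HK: "\<And>z i. \<lbrakk>i \<in> topspace X; z \<in> topspace (prod_topology X ?I) \<inter> (N i \<times> {0..1})\<rbrakk>
                   \<Longrightarrow> H z = K i z"
    by blast
  show ?thesis
  proof (rule that[OF H])
    show "H (x, 0) = f x" if "x \<in> topspace X" for x
      using HK[of x "(x, 0)"] K0[of x x] inN that by auto
    show "q (H (x, t)) = h (x, t)" if "x \<in> topspace X" "t \<in> {0..1}" for x t
      using HK[of x "(x, t)"] qK[of x x t] inN that by auto
  qed
qed

lemma path_lifting:
  assumes cov: "covering_map E B q" and g: "pathin B g"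
    and a: "a \<in> topspace E" "q a = g 0"
  obtains g' where "pathin E g'" "g' 0 = a" "\<And>t. t \<in> {0..1} \<Longrightarrow> q (g' t) = g t"
proof -
  let ?I = "top_of_set {0..1::real}"
  \<comment> \<open>A path is a homotopy of maps on a one-point space.\<close>
  let ?X = "discrete_topology {()}"
  have "continuous_map (prod_topology ?X ?I) B (g \<circ> snd)"
    using g continuous_map_compose[OF continuous_map_snd] unfolding pathin_def by blast
  moreover have "continuous_map ?X E (\<lambda>_. a)"
    using a by simp
  ultimately obtain H where H: "continuous_map (prod_topology ?X ?I) E H"
      "H ((), 0) = a" "\<And>t. t \<in> {0..1} \<Longrightarrow> q (H ((), t)) = g t"
    by (rule homotopy_lifting[OF cov]) (use a in auto)
  have "continuous_map ?I (prod_topology ?X ?I) (Pair ())"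
    by (simp add: continuous_map_pairwise o_def)
  from continuous_map_compose[OF this H(1)] have "pathin E (\<lambda>t. H ((), t))"
    by (simp add: pathin_def o_def)
  with H(2,3) show ?thesis
    using that by blast
qed

section \<open>Lifting over locally path connected spaces\<close>

text \<open>A sheet is homeomorphic to an open subset of the base, so it inherits the property.\<close>

lemma covering_map_locally_path_connected:
  assumes cov: "covering_map E B q" and B: "locally_path_connected_space B"
  shows "locally_path_connected_space E"
  unfolding locally_path_connected_space
proof (intro allI impI, elim conjE)
  fix W a assume W: "openin E W" and a: "a \<in> W"
  have aE: "a \<in> topspace E"
    using W a openin_subset by blast
  then have "q a \<in> topspace B"
    using cov by (auto simp: covering_map_def)
  then obtain U where U: "openin B U" "q a \<in> U"
    "\<And>a. \<lbrakk>a \<in> topspace E; q a \<in> U\<rbrakk> \<Longrightarrow> \<exists>V. sheet_over E B q U V \<and> a \<in> V"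
    using covering_map_sheets[OF cov] by metis
  then obtain V where V: "sheet_over E B q U V" "a \<in> V"
    using aE by blast
  have "subtopology E V homeomorphic_space subtopology B U"
    using V(1) homeomorphic_map_imp_homeomorphic_space unfolding sheet_over_def by blast
  then have "locally_path_connected_space (subtopology E V)"
    using homeomorphic_locally_path_connected_space locally_path_connected_space_open_subset[OF B U(1)]
    by blast
  moreover have "openin (subtopology E V) (V \<inter> W)"
    using W by (simp add: openin_subtopology_Int2)
  ultimately obtain A where "openin (subtopology E V) A" "path_connectedin (subtopology E V) A"
    "a \<in> A" "A \<subseteq> V \<inter> W"
    using a V(2) unfolding locally_path_connected_space by blast
  then show "\<exists>A. openin E A \<and> path_connectedin E A \<and> a \<in> A \<and> A \<subseteq> W"
    using V(1) by (auto simp: sheet_over_def openin_open_subtopology path_connectedin_subtopology)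
qed

lemma locally_path_connected_imp_path_connected_space:
  assumes "connected_space X" "locally_path_connected_space X"
  shows "path_connected_space X"
  using assms path_component_eq_connected_component_of[OF assms(2)]
  by (metis connected_space_iff_connected_component path_connected_space_iff_path_component mem_Collect_eq)

text \<open>The set-theoretic lift \<open>F\<close> of a continuous map can fail to be continuous only by jumping between
  sheets, and continuity along paths excludes a jump between points joined by a small path. This reduces the continuity of
  the group operations on the cover to that of paths and their lifts.\<close>

lemma continuous_map_if_continuous_along_paths:
  assumes cov: "covering_map E B q" and X: "locally_path_connected_space X"
    and FE: "\<And>x. x \<in> topspace X \<Longrightarrow> F x \<in> topspace E"
    and qF: "continuous_map X B (q \<circ> F)"
    and paths: "\<And>\<gamma>. pathin X \<gamma> \<Longrightarrow> pathin E (F \<circ> \<gamma>)"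
  shows "continuous_map X E F"
  unfolding continuous_map_eq_topcontinuous_at topcontinuous_at_def
proof (intro ballI conjI allI impI)
  fix x O' assume x: "x \<in> topspace X" and O': "openin E O' \<and> F x \<in> O'"
  have "q (F x) \<in> topspace B"
    using cov FE[OF x] by (auto simp: covering_map_def)
  then obtain U where U: "openin B U" "q (F x) \<in> U"
    "\<And>a. \<lbrakk>a \<in> topspace E; q a \<in> U\<rbrakk> \<Longrightarrow> \<exists>V. sheet_over E B q U V \<and> a \<in> V"
    using covering_map_sheets[OF cov] by metis
  then obtain V where V: "sheet_over E B q U V" "F x \<in> V"
    using FE[OF x] by blast
  have "openin E (V \<inter> O')"
    using V O' by (auto simp: sheet_over_def)
  then have "openin B (q ` (V \<inter> O'))"
    using sheet_over_open_image[OF V(1) U(1)] by blast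
  then have "openin X {z \<in> topspace X. (q \<circ> F) z \<in> q ` (V \<inter> O')}"
    by (rule openin_continuous_map_preimage[OF qF])
  moreover have "x \<in> {z \<in> topspace X. (q \<circ> F) z \<in> q ` (V \<inter> O')}"
    using x V O' by auto
  ultimately obtain A where A: "openin X A" "path_connectedin X A" "x \<in> A"
    "A \<subseteq> {z \<in> topspace X. (q \<circ> F) z \<in> q ` (V \<inter> O')}"
    using X unfolding locally_path_connected_space by meson
  have qA: "q (F z) \<in> q ` (V \<inter> O')" if "z \<in> A" for z
    using A(4) that by auto
  have "F z \<in> O'" if z: "z \<in> A" for z
  proof -
    obtain \<gamma> where \<gamma>: "pathin X \<gamma>" "\<gamma> \<in> {0..1} \<rightarrow> A" "\<gamma> 0 = x" "\<gamma> 1 = z"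
      using A z unfolding path_connectedin by meson
    have "(F \<circ> \<gamma>) 1 \<in> V"
    proof (rule connected_lift_in_sheet[OF connected_unit_interval _ V(1)])
      show "continuous_map (top_of_set {0..1}) E (F \<circ> \<gamma>)"
        using paths[OF \<gamma>(1)] by (simp add: pathin_def)
      show "q ((F \<circ> \<gamma>) t) \<in> U" if "t \<in> topspace (top_of_set {0..1})" for t
      proof -
        have "\<gamma> t \<in> A"
          using \<gamma>(2) that by auto
        then show ?thesis
          using qA sheet_over_subset[OF V(1)] by fastforce
      qed
      show "(F \<circ> \<gamma>) 0 \<in> V"
        using V \<gamma> by simp
    qed auto
    then have "F z \<in> V"
      using \<gamma> by simp
    with qA[OF z] sheet_over_inj_on[OF V(1)] show ?thesis
      by (auto simp: inj_on_def)
  qed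
  with A show "\<exists>U. openin X U \<and> x \<in> U \<and> (\<forall>y\<in>U. F y \<in> O')"
    by blast
qed (use FE in auto)


text \<open>The fundamental group of \<open>X \<times> Y\<close> is generated by the loops in \<open>X \<times> {y0}\<close> and \<open>{x0} \<times> Y\<close>, so a
  map that lifts compatibly on these two axes satisfies the lifting criterion. The proof replaces
  this computation by uniqueness of lifts over \<open>X\<close>: moving the lift \<open>f\<close> of \<open>M(\<cdot>, y0)\<close> along a path in
  \<open>Y\<close> from \<open>y0\<close> to \<open>y\<close> gives a lift of \<open>M(\<cdot>, y)\<close> whose value at \<open>x0\<close> is forced to be \<open>g y\<close>; as \<open>X\<close> is
  connected, it does not depend on the path.\<close>

lemma product_lifting:
  assumes cov: "covering_map E B q"
    and X: "connected_space X" "locally_path_connected_space X" "x0 \<in> topspace X"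
    and Y: "path_connected_space Y" "locally_path_connected_space Y" "y0 \<in> topspace Y"
    and M: "continuous_map (prod_topology X Y) B M"
    and f: "continuous_map X E f" "\<And>x. x \<in> topspace X \<Longrightarrow> q (f x) = M (x, y0)"
    and g: "continuous_map Y E g" "\<And>y. y \<in> topspace Y \<Longrightarrow> q (g y) = M (x0, y)"
    and fg: "f x0 = g y0"
  obtains F where "continuous_map (prod_topology X Y) E F"
    "\<And>z. z \<in> topspace (prod_topology X Y) \<Longrightarrow> q (F z) = M z"
    "\<And>x. x \<in> topspace X \<Longrightarrow> F (x, y0) = f x"
    "\<And>y. y \<in> topspace Y \<Longrightarrow> F (x0, y) = g y"
proof -
  let ?I = "top_of_set {0..1::real}"
  \<comment> \<open>By connectedness of \<open>X\<close>, the prescribed value at \<open>x0\<close> leaves at most one slice over each \<open>y\<close>.\<close>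
  define slice where "slice y k \<longleftrightarrow>
      continuous_map X E k \<and> (\<forall>x\<in>topspace X. q (k x) = M (x, y)) \<and> k x0 = g y" for y k
  have slice_unique: "k x = k' x" if "slice y k" "slice y k'" "x \<in> topspace X" for y k k' x
    by (rule covering_map_lift_unique[OF cov X(1), of k k' x0])
       (use that X(3) in \<open>auto simp: slice_def\<close>)
  have transport: "\<exists>H. continuous_map (prod_topology X ?I) E H \<and>
      (\<forall>x\<in>topspace X. H (x, 0) = k x) \<and> (\<forall>t\<in>{0..1}. slice (\<gamma> t) (\<lambda>x. H (x, t)))"
    if \<gamma>: "pathin Y \<gamma>" and k: "slice (\<gamma> 0) k" for \<gamma> k
  proof -
    have \<gamma>c: "continuous_map ?I Y \<gamma>"
      using \<gamma> by (simp add: pathin_def)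
    then have \<gamma>Y: "\<gamma> t \<in> topspace Y" if "t \<in> {0..1}" for t
      using that by (auto simp: continuous_map_def)
    have "continuous_map (prod_topology X ?I) (prod_topology X Y) (\<lambda>z. (fst z, \<gamma> (snd z)))"
      using continuous_map_compose[OF continuous_map_snd \<gamma>c]
      by (simp add: continuous_map_pairwise o_def continuous_map_fst)
    from continuous_map_compose[OF this M]
    have Mc: "continuous_map (prod_topology X ?I) B (\<lambda>z. M (fst z, \<gamma> (snd z)))"
      by (simp add: o_def)
    have kc: "continuous_map X E k"
      using k by (simp add: slice_def)
    obtain H where H: "continuous_map (prod_topology X ?I) E H"
      and H0: "\<And>x. x \<in> topspace X \<Longrightarrow> H (x, 0) = k x"
      and qH: "\<And>x t. \<lbrakk>x \<in> topspace X; t \<in> {0..1}\<rbrakk> \<Longrightarrow> q (H (x, t)) = M (x, \<gamma> t)"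
      by (rule homotopy_lifting[OF cov Mc kc]) (use k in \<open>auto simp: slice_def\<close>)
    have "slice (\<gamma> t) (\<lambda>x. H (x, t))" if t: "t \<in> {0..1}" for t
    proof -
      have "continuous_map X (prod_topology X ?I) (\<lambda>x. (x, t))"
        using t by (simp add: continuous_map_pairwise o_def)
      from continuous_map_compose[OF this H] have 1: "continuous_map X E (\<lambda>x. H (x, t))"
        by (simp add: o_def)
      have "continuous_map ?I (prod_topology X ?I) (\<lambda>t. (x0, t))"
        using X(3) by (simp add: continuous_map_pairwise o_def)
      from continuous_map_compose[OF this H] have Hx0: "continuous_map ?I E (\<lambda>t. H (x0, t))"
        by (simp add: o_def)
      have g\<gamma>: "continuous_map ?I E (\<lambda>t. g (\<gamma> t))"
        using continuous_map_compose[OF \<gamma>c g(1)] by (simp add: o_def)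
      have "H (x0, t) = g (\<gamma> t)"
        by (rule covering_map_lift_unique[OF cov connected_unit_interval Hx0 g\<gamma>, of 0])
           (use t X(3) qH g(2) \<gamma>Y H0 k in \<open>auto simp: slice_def\<close>)
      with 1 t qH show ?thesis
        by (simp add: slice_def)
    qed
    with H H0 show ?thesis
      by blast
  qed
  have slice0: "slice y0 f"
    using f fg by (simp add: slice_def)
  have "\<exists>k. slice y k" if y: "y \<in> topspace Y" for y
  proof -
    obtain \<gamma> where \<gamma>: "pathin Y \<gamma>" "\<gamma> 0 = y0" "\<gamma> 1 = y"
      using Y(1,3) y unfolding path_connected_space_def by blast
    then obtain H where "\<forall>t\<in>{0..1}. slice (\<gamma> t) (\<lambda>x. H (x, t))"
      using transport[of \<gamma> f] slice0 by auto
    then have "slice (\<gamma> 1) (\<lambda>x. H (x, 1))"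
      by simp
    with \<gamma> show ?thesis
      by auto
  qed
  then obtain k where k: "\<And>y. y \<in> topspace Y \<Longrightarrow> slice y (k y)"
    by metis
  define F where "F z = k (snd z) (fst z)" for z
  have qF: "q (F z) = M z" if "z \<in> topspace (prod_topology X Y)" for z
    using that k by (auto simp: F_def slice_def)
  have "continuous_map (prod_topology X Y) E F"
  proof (rule continuous_map_if_continuous_along_paths[OF cov])
    show "locally_path_connected_space (prod_topology X Y)"
      using X Y by (simp add: locally_path_connected_space_prod_topology)
    show "F z \<in> topspace E" if "z \<in> topspace (prod_topology X Y)" for z
    proof -
      have "continuous_map X E (k (snd z))"
        using k[of "snd z"] that by (auto simp: slice_def)
      then show ?thesis
        using that by (auto simp: F_def continuous_map_def)
    qed
    show "continuous_map (prod_topology X Y) B (q \<circ> F)"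
      by (rule continuous_map_eq[OF M]) (simp add: qF)
    \<comment> \<open>Transport along the second component of \<open>\<delta>\<close>, evaluated at the first component: by uniqueness
      of slices this jointly continuous \<open>H\<close> computes \<open>F\<close> along \<open>\<delta>\<close>.\<close>
    fix \<delta> assume "pathin (prod_topology X Y) \<delta>"
    then have \<delta>: "continuous_map ?I (prod_topology X Y) \<delta>"
      by (simp add: pathin_def)
    then have \<delta>1: "continuous_map ?I X (fst \<circ> \<delta>)" and \<delta>2: "pathin Y (snd \<circ> \<delta>)"
      by (simp_all add: continuous_map_pairwise pathin_def)
    have in1: "fst (\<delta> t) \<in> topspace X" and in2: "snd (\<delta> t) \<in> topspace Y" if "t \<in> {0..1}" for t
      using \<delta> that by (force simp: continuous_map_def)+
    obtain H where H: "continuous_map (prod_topology X ?I) E H"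
      and sl: "\<And>t. t \<in> {0..1} \<Longrightarrow> slice (snd (\<delta> t)) (\<lambda>x. H (x, t))"
      using transport[OF \<delta>2, of "k (snd (\<delta> 0))"] k[OF in2[of 0]] by auto
    have "continuous_map ?I (prod_topology X ?I) (\<lambda>t. (fst (\<delta> t), t))"
      using \<delta>1 by (simp add: continuous_map_pairwise o_def)
    from continuous_map_compose[OF this H]
    have "continuous_map ?I E (\<lambda>t. H (fst (\<delta> t), t))"
      by (simp add: o_def)
    moreover have "H (fst (\<delta> t), t) = (F \<circ> \<delta>) t" if "t \<in> topspace ?I" for t
      using that slice_unique[OF sl k[OF in2] in1, of t] by (simp add: F_def)
    ultimately show "pathin E (F \<circ> \<delta>)"
      unfolding pathin_def by (rule continuous_map_eq)
  qed
  moreover have "F (x, y0) = f x" if "x \<in> topspace X" for x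
    using slice_unique[OF k[OF Y(3)] slice0 that] by (simp add: F_def)
  moreover have "F (x0, y) = g y" if "y \<in> topspace Y" for y
    using k[OF that] by (simp add: F_def slice_def)
  ultimately show ?thesis
    using that qF by blast
qed

section \<open>The group structure on the covering space\<close>

theorem theorem3p9:
  fixes G :: "('g, 'm) monoid_scheme" and T :: "'g topology"
    and T' :: "'c topology" and q :: "'c \<Rightarrow> 'g"
  assumes "topological_group G T"
    and "connected_space T"
    and "locally_path_connected_space T"
    and "covering_map T' T q"
    and "connected_space T'"
  shows "\<exists>G' :: 'c monoid. topological_group G' T' \<and> q \<in> hom G' G"
proof -
  interpret topological_group G T by fact
  note cov = \<open>covering_map T' T q\<close>
  have qc: "continuous_map T' T q" and qsurj: "q ` topspace T' = topspace T"
    using cov by (auto simp: covering_map_def)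
  have lpc: "locally_path_connected_space T'"
    using covering_map_locally_path_connected[OF cov] assms(3) .
  have pc: "path_connected_space T'"
    using locally_path_connected_imp_path_connected_space[OF assms(5) lpc] .
  have qG: "q a \<in> carrier G" if "a \<in> topspace T'" for a
    using that qsurj topspace_eq by blast
  obtain e where e: "e \<in> topspace T'" "q e = \<one>\<^bsub>G\<^esub>"
    using qsurj topspace_eq one_closed by (metis imageE)
  have "continuous_map (prod_topology T' T') (prod_topology T T) (\<lambda>z. (q (fst z), q (snd z)))"
    using continuous_map_compose[OF continuous_map_fst[of T' T'] qc]
      continuous_map_compose[OF continuous_map_snd[of T' T'] qc]
    by (simp add: continuous_map_paired o_def)
  from continuous_map_compose[OF this continuous_mult]
  have "continuous_map (prod_topology T' T') T (\<lambda>z. q (fst z) \<otimes>\<^bsub>G\<^esub> q (snd z))"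
    by (simp add: o_def)
  then obtain m where m: "continuous_map (prod_topology T' T') T' m"
    and qm': "\<And>z. z \<in> topspace (prod_topology T' T') \<Longrightarrow> q (m z) = q (fst z) \<otimes>\<^bsub>G\<^esub> q (snd z)"
    and me: "\<And>a. a \<in> topspace T' \<Longrightarrow> m (a, e) = a" and em: "\<And>b. b \<in> topspace T' \<Longrightarrow> m (e, b) = b"
    by (rule product_lifting[OF cov assms(5) lpc e(1) pc lpc e(1), where f = "\<lambda>a. a" and g = "\<lambda>b. b"])
       (use qG e in auto)
  have qm: "q (m (a, b)) = q a \<otimes>\<^bsub>G\<^esub> q b" if "a \<in> topspace T'" "b \<in> topspace T'" for a b
    using qm'[of "(a, b)"] that by simp
  have mT: "m (a, b) \<in> topspace T'" if "a \<in> topspace T'" "b \<in> topspace T'" for a b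
    using m that by (auto simp: continuous_map_def)
  have m_comp: "continuous_map Z T' (\<lambda>z. m (u z, v z))"
    if "continuous_map Z T' u" "continuous_map Z T' v" for Z :: "'z topology" and u v
    using continuous_map_compose[OF continuous_map_pairedI[OF that] m] by (simp add: o_def)
  have assoc: "m (m (a, b), c) = m (a, m (b, c))"
    if "a \<in> topspace T'" "b \<in> topspace T'" "c \<in> topspace T'" for a b c
  proof (rule covering_map_lift_unique[OF cov assms(5), where y = a and ?y0.0 = e])
    show "continuous_map T' T' (\<lambda>a. m (m (a, b), c))" "continuous_map T' T' (\<lambda>a. m (a, m (b, c)))"
      using that mT by (auto intro!: m_comp)
  qed (use that e em mT qm qG m_assoc in auto)
  \<comment> \<open>The initial value \<open>b'\<close> is arbitrary because the statement is used twice: from \<open>e\<close>, to obtain inverses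
    at all, and from the inverse of any \<open>\<beta> 0\<close>, to show that inversion is continuous along \<open>\<beta>\<close>.\<close>
  have inv_path: "\<exists>\<beta>'. pathin T' \<beta>' \<and> \<beta>' 0 = b' \<and> (\<forall>t\<in>{0..1}. m (\<beta>' t, \<beta> t) = e)"
    if \<beta>: "pathin T' \<beta>" and b': "b' \<in> topspace T'" "m (b', \<beta> 0) = e" for \<beta> b'
  proof -
    have \<beta>T: "\<beta> t \<in> topspace T'" if "t \<in> {0..1}" for t
      using \<beta> that by (auto simp: pathin_def continuous_map_def)
    have "pathin T (\<lambda>t. inv\<^bsub>G\<^esub> q (\<beta> t))"
      using pathin_compose[OF pathin_compose[OF \<beta> qc] continuous_inv] by (simp add: o_def)
    moreover have "q b' = inv\<^bsub>G\<^esub> q (\<beta> 0)"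
      using qm[OF b'(1) \<beta>T[of 0]] b' e qG \<beta>T by (simp add: inv_equality)
    ultimately obtain \<beta>' where \<beta>': "pathin T' \<beta>'" "\<beta>' 0 = b'"
        "\<And>t. t \<in> {0..1} \<Longrightarrow> q (\<beta>' t) = inv\<^bsub>G\<^esub> q (\<beta> t)"
      using path_lifting[OF cov _ b'(1)] by metis
    have \<beta>'T: "\<beta>' t \<in> topspace T'" if "t \<in> {0..1}" for t
      using \<beta>' that by (auto simp: pathin_def continuous_map_def)
    have "m (\<beta>' t, \<beta> t) = e" if "t \<in> {0..1}" for t
    proof (rule covering_map_lift_unique[OF cov connected_unit_interval, where y = t and ?y0.0 = 0])
      show "continuous_map (top_of_set {0..1}) T' (\<lambda>t. m (\<beta>' t, \<beta> t))"
        using \<beta> \<beta>' by (auto simp: pathin_def intro!: m_comp)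
    qed (use that e qm qG \<beta>T \<beta>'T \<beta>' b' in auto)
    with \<beta>' show ?thesis
      by blast
  qed
  define G' where "G' = \<lparr>carrier = topspace T', mult = (\<lambda>a b. m (a, b)), one = e\<rparr>"
  have G'simps: "carrier G' = topspace T'" "\<And>a b. a \<otimes>\<^bsub>G'\<^esub> b = m (a, b)" "\<one>\<^bsub>G'\<^esub> = e"
    by (simp_all add: G'_def)
  have G': "group G'"
  proof (rule groupI)
    fix b assume "b \<in> carrier G'"
    then have b: "b \<in> topspace T'"
      by (simp add: G'simps)
    then obtain \<beta> where \<beta>: "pathin T' \<beta>" "\<beta> 0 = e" "\<beta> 1 = b"
      using pc e unfolding path_connected_space_def by blast
    then obtain \<beta>' where \<beta>': "pathin T' \<beta>'" "\<forall>t\<in>{0..1}. m (\<beta>' t, \<beta> t) = e"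
      using inv_path[of \<beta> e] e me by auto
    then have "m (\<beta>' 1, b) = e" "\<beta>' 1 \<in> topspace T'"
      using \<beta> by (auto simp: pathin_def continuous_map_def)
    then show "\<exists>a\<in>carrier G'. a \<otimes>\<^bsub>G'\<^esub> b = \<one>\<^bsub>G'\<^esub>"
      by (auto simp: G'simps)
  qed (use mT assoc em e in \<open>auto simp: G'simps\<close>)
  interpret G': group G' by (rule G')
  have hom: "q \<in> hom G' G"
    using qG qm by (auto simp: hom_def G'simps)
  then interpret qhom: group_hom G' G q
    by unfold_locales
  have invc: "continuous_map T' T' (\<lambda>a. inv\<^bsub>G'\<^esub> a)"
  proof (rule continuous_map_if_continuous_along_paths[OF cov lpc])
    show "inv\<^bsub>G'\<^esub> a \<in> topspace T'" if "a \<in> topspace T'" for a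
      using G'.inv_closed that by (simp add: G'simps)
    have "continuous_map T' T (\<lambda>a. inv\<^bsub>G\<^esub> q a)"
      using continuous_map_compose[OF qc continuous_inv] by (simp add: o_def)
    then show "continuous_map T' T (q \<circ> (\<lambda>a. inv\<^bsub>G'\<^esub> a))"
      by (rule continuous_map_eq) (simp add: G'simps)
    fix \<gamma> assume \<gamma>: "pathin T' \<gamma>"
    then have \<gamma>T: "\<gamma> t \<in> carrier G'" if "t \<in> {0..1}" for t
      using that by (auto simp: pathin_def continuous_map_def G'simps)
    obtain \<gamma>' where \<gamma>': "pathin T' \<gamma>'" "\<forall>t\<in>{0..1}. m (\<gamma>' t, \<gamma> t) = e"
      using inv_path[OF \<gamma>, of "inv\<^bsub>G'\<^esub> \<gamma> 0"] \<gamma>T[of 0] G'.l_inv[of "\<gamma> 0"] G'.inv_closed[of "\<gamma> 0"]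
      by (auto simp: G'simps)
    have "\<gamma>' t = ((\<lambda>a. inv\<^bsub>G'\<^esub> a) \<circ> \<gamma>) t" if "t \<in> topspace (top_of_set {0..1})" for t
    proof -
      have "\<gamma>' t \<in> carrier G'"
        using \<gamma>'(1) that by (auto simp: pathin_def continuous_map_def G'simps)
      then show ?thesis
        using G'.inv_equality[of "\<gamma>' t" "\<gamma> t"] \<gamma>' \<gamma>T that by (simp add: G'simps)
    qed
    with \<gamma>'(1) show "pathin T' ((\<lambda>a. inv\<^bsub>G'\<^esub> a) \<circ> \<gamma>)"
      unfolding pathin_def by (blast intro: continuous_map_eq)
  qed
  have "topological_group G' T'"
  proof
    show "topspace T' = carrier G'"
      by (simp add: G'simps)
    show "continuous_map (prod_topology T' T') T' (\<lambda>(x, y). x \<otimes>\<^bsub>G'\<^esub> y)"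
      using m by (simp add: G'simps case_prod_unfold)
  qed (rule invc)
  with hom show ?thesis
    by blast
qed

end
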